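(* Let $m,k\in\mathbb N$ with $m>k$. Then $$\operatorname{Car}_{\ell_\infty^{2^m}}(k)\ge1-\frac km.$$ In particular, $$\operatorname{Car}_{\ell_\infty^{2^{2k}}}(k)\ge\frac12.$$
   Context: $\ell_\infty^N$ is $\mathbb R^N$ with the maximum norm. For a Banach space $X$ and $P\subset X$, $\operatorname{conv}_k P=\{\sum_{i=1}^s\lambda_i x_i: 1\le s\le k,\ x_i\in P,\ \lambda_i\ge0,\ \sum\lambda_i=1\}$, and $\operatorname{Car}_X(k)=\sup_P\sup_{a\in\operatorname{conv}P}\frac{\operatorname{dist}(a,\operatorname{conv}_kP)}{\operatorname{diam}P}$, the supremum over bounded sets $P\subset X$ of positive diameter. *)

theory Defs
  imports "HOL-Analysis.Analysis"
begin

definition conv_upto :: "nat \<Rightarrow> 'a::real_vector set \<Rightarrow> 'a set" where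
  "conv_upto k P =
    {\<Sum>i<s. c i *\<^sub>R x i | s c x. 1 \<le> s \<and> s \<le> k \<and>
       (\<forall>i<s. x i \<in> P) \<and> (\<forall>i<s. 0 \<le> c i) \<and> (\<Sum>i<s. c i) = (1::real)}"

text \<open>
  The space \<open>X\<close> is a linear subspace of a normed space, with the inherited norm, so that its
  dimension can be a term. Convex combinations, distances and diameters of subsets of \<open>X\<close> do not
  depend on the ambient space. For \<open>k \<ge> 1\<close> all the real suprema below are over sets that are
  bounded above: see \<open>Car_ratio_bounds\<close> and \<open>bdd_above_Car\<close>. For \<open>k = 0\<close> the set
  \<open>conv_upto k P\<close> is empty, and for \<open>X = {0}\<close> there is no admissible \<open>P\<close>; the value of
  \<open>Car\<close> then has no meaning.
\<close>

definition Car :: "'a::real_normed_vector set \<Rightarrow> nat \<Rightarrow> real" where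
  "Car X k =
    (SUP P \<in> {P. P \<subseteq> X \<and> bounded P \<and> diameter P > 0}.
       SUP a \<in> convex hull P. infdist a (conv_upto k P) / diameter P)"

text \<open>
  \<open>nat \<Rightarrow>\<^sub>C real\<close> is the Banach space of all bounded real sequences with the supremum norm
  (every sequence is continuous, as \<^typ>\<open>nat\<close> is discrete). The vectors of \<open>\<real>\<^sup>N\<close> are identified
  with the sequences that vanish from index \<open>N\<close> on; on these the norm is the maximum norm
  (\<open>norm_linfty\<close>), and every vector of \<open>\<real>\<^sup>N\<close> occurs exactly once (\<open>ex1_linfty\<close>).
\<close>

definition linfty :: "nat \<Rightarrow> (nat \<Rightarrow>\<^sub>C real) set" where
  "linfty N = {x. \<forall>i\<ge>N. apply_bcontfun x i = 0}"

lemma subspace_linfty: "subspace (linfty N)"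
  by (auto simp: subspace_def linfty_def)

lemma complete_linfty: "complete (linfty N)"
  unfolding complete_def
proof (intro allI impI, elim conjE)
  fix f :: "nat \<Rightarrow> nat \<Rightarrow>\<^sub>C real"
  assume f: "\<forall>n. f n \<in> linfty N" and "Cauchy f"
  then obtain g where "uniform_limit UNIV f g sequentially"
    using uniformly_convergent_eq_cauchy[of "\<lambda>_. True" f]
    unfolding Cauchy_def uniform_limit_sequentially_iff
    by (metis dist_fun_lt_imp_dist_val_lt)
  from uniform_limit_bcontfunE[OF this sequentially_bot]
  obtain l where l: "f \<longlonglongrightarrow> l"
    by metis
  have "apply_bcontfun l i = 0" if "i \<ge> N" for i
  proof -
    have "(\<lambda>n. apply_bcontfun (f n) i) \<longlonglongrightarrow> apply_bcontfun l i"
      using tendsto_bcontfun_uniform_limit[OF l] by (rule tendsto_uniform_limitI) simp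
    moreover have "(\<lambda>n. apply_bcontfun (f n) i) = (\<lambda>_. 0)"
      using f that by (auto simp: linfty_def)
    ultimately show ?thesis
      by (simp add: LIMSEQ_const_iff)
  qed
  with l show "\<exists>l\<in>linfty N. f \<longlonglongrightarrow> l"
    by (auto simp: linfty_def)
qed

lemma norm_linfty:
  assumes "x \<in> linfty N" "N > 0"
  shows "norm x = Max ((\<lambda>i. \<bar>apply_bcontfun x i\<bar>) ` {..<N})"
proof (rule antisym)
  let ?M = "Max ((\<lambda>i. \<bar>apply_bcontfun x i\<bar>) ` {..<N})"
  have le: "\<bar>apply_bcontfun x i\<bar> \<le> ?M" if "i < N" for i
    using that by (intro Max_ge) auto
  have "0 \<le> ?M"
    using le[OF assms(2)] by linarith
  then have "norm (apply_bcontfun x i) \<le> ?M" for i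
    using le[of i] assms(1) by (cases "i < N") (auto simp: linfty_def)
  then show "norm x \<le> ?M"
    by (rule norm_bound)
  show "?M \<le> norm x"
    using assms(2) norm_bounded[of x] by (subst Max_le_iff) auto
qed

lemma ex1_linfty:
  fixes v :: "nat \<Rightarrow> real"
  shows "\<exists>!x. x \<in> linfty N \<and> (\<forall>i<N. apply_bcontfun x i = v i)"
proof -
  let ?f = "\<lambda>i. if i < N then v i else 0"
  have "range ?f \<subseteq> insert 0 (v ` {..<N})"
    by auto
  then have "finite (range ?f)"
    by (rule finite_subset) simp
  then have "?f \<in> bcontfun"
    by (auto simp: bcontfun_def intro: finite_imp_bounded)
  then obtain x where x: "?f = apply_bcontfun x"
    by (rule bcontfunE)
  have val: "apply_bcontfun x i = (if i < N then v i else 0)" for i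
    using fun_cong[OF x, of i] by simp
  show ?thesis
  proof (rule ex1I[of _ x])
    show "x \<in> linfty N \<and> (\<forall>i<N. apply_bcontfun x i = v i)"
      by (simp add: linfty_def val)
  next
    fix y assume y: "y \<in> linfty N \<and> (\<forall>i<N. apply_bcontfun y i = v i)"
    show "y = x"
    proof (rule bcontfun_eqI)
      fix i
      show "apply_bcontfun y i = apply_bcontfun x i"
        using y by (cases "i < N") (auto simp: linfty_def val)
    qed
  qed
qed

lemma Car_ratio_bounds:
  fixes P :: "'a::real_normed_vector set"
  assumes k: "k \<ge> 1" and P: "bounded P" "diameter P > 0" and a: "a \<in> convex hull P"
  shows "0 \<le> infdist a (conv_upto k P) / diameter P"
    and "infdist a (conv_upto k P) / diameter P \<le> 1"
proof -
  show "0 \<le> infdist a (conv_upto k P) / diameter P"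
    using P(2) by (simp add: infdist_nonneg)
  obtain p where p: "p \<in> P"
    using P(2) by (cases "P = {}") auto
  have "p \<in> conv_upto k P"
    unfolding conv_upto_def
    by (intro CollectI exI[of _ "1::nat"] exI[of _ "\<lambda>_. 1::real"] exI[of _ "\<lambda>_. p"])
      (use k p in auto)
  then have 1: "infdist a (conv_upto k P) \<le> dist a p"
    by (rule infdist_le)
  have "P \<subseteq> cball p (diameter P)"
    using diameter_bounded_bound[OF P(1) p] by auto
  then have "convex hull P \<subseteq> cball p (diameter P)"
    by (rule hull_minimal) simp
  then have "dist a p \<le> diameter P"
    using a by (auto simp: dist_commute)
  then show "infdist a (conv_upto k P) / diameter P \<le> 1"
    using 1 P(2) by simp
qed

lemma bdd_above_Car:
  fixes X :: "'a::real_normed_vector set"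
  assumes k: "k \<ge> 1"
  shows "bdd_above ((\<lambda>P. SUP a \<in> convex hull P. infdist a (conv_upto k P) / diameter P) `
           {P. P \<subseteq> X \<and> bounded P \<and> diameter P > 0})"
proof (rule bdd_aboveI2[where M = 1])
  fix P assume "P \<in> {P. P \<subseteq> X \<and> bounded P \<and> diameter P > 0}"
  then have P: "bounded P" "diameter P > 0"
    by auto
  then have "P \<noteq> {}"
    by auto
  then show "(SUP a \<in> convex hull P. infdist a (conv_upto k P) / diameter P) \<le> 1"
    using Car_ratio_bounds(2)[OF k P] by (intro cSUP_least) auto
qed

end

theory Submission
  imports Defs
begin

text \<open>
  Index the \<open>2 ^ m\<close> coordinates by the subsets of \<open>{..<m}\<close>, and let the \<open>i\<close>-th point have
  coordinate \<open>-1\<close> at \<open>S\<close> if \<open>i \<in> S\<close> and \<open>1\<close> otherwise: this is the isometric image of the standard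
  basis of \<open>\<ell>\<^sub>1\<^sup>m\<close>, of diameter \<open>2\<close>. If \<open>S\<close> is the set of points used by a combination of at most
  \<open>k\<close> points, then at \<open>S\<close> this combination has coordinate \<open>-1\<close> and the barycentre of all \<open>m\<close> points
  has coordinate \<open>1 - 2 * card S / m\<close>, so their distance is at least \<open>2 * (1 - k / m)\<close>.
\<close>

text \<open>The quotients are at most 1 when \<open>k \<ge> 1\<close>, so both real suprema are
  taken over sets bounded above, and one pair \<open>P\<close>, \<open>a\<close> bounds
  \<open>Car\<close> from below.\<close>

lemma Car_lower_bound:
  fixes X :: "'a::real_normed_vector set"
  assumes k: "k \<ge> 1" and P: "P \<subseteq> X" "bounded P" "diameter P > 0" and a: "a \<in> convex hull P"
  shows "infdist a (conv_upto k P) / diameter P \<le> Car X k"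
proof -
  have "infdist a (conv_upto k P) / diameter P
      \<le> (SUP a \<in> convex hull P. infdist a (conv_upto k P) / diameter P)"
    using Car_ratio_bounds(2)[OF k P(2,3)] by (intro cSUP_upper[OF a] bdd_aboveI2) auto
  also have "\<dots> \<le> Car X k"
    unfolding Car_def using P by (intro cSUP_upper bdd_above_Car[OF k]) auto
  finally show ?thesis .
qed

lemma conv_upto_nonempty:
  assumes "k \<ge> 1" "p \<in> P"
  shows "conv_upto k P \<noteq> {}"
proof -
  have "p \<in> conv_upto k P"
    unfolding conv_upto_def
    by (intro CollectI exI[of _ "1::nat"] exI[of _ "\<lambda>_. 1::real"] exI[of _ "\<lambda>_. p"])
      (use assms in auto)
  then show ?thesis by auto
qed

lemma apply_bcontfun_sum:
  "apply_bcontfun (\<Sum>i\<in>A. f i) x = (\<Sum>i\<in>A. apply_bcontfun (f i) x)"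
  by (induction A rule: infinite_finite_induct) auto

lemma set_encode_less_power:
  assumes "S \<subseteq> {..<m}"
  shows "set_encode S < 2 ^ m"
proof -
  have "set_encode S \<le> (\<Sum>i<m. 2 ^ i)"
    unfolding set_encode_def using assms by (intro sum_mono2) auto
  also have "\<dots> < 2 ^ m"
    by (induction m) auto
  finally show ?thesis .
qed

text \<open>Coordinate \<open>j\<close> stands for the subset \<open>set_decode j\<close> of
  \<open>{..<m}\<close>; from \<open>2 ^ m\<close> on the sequence is 0. The description is proper
  by \<open>ex1_linfty\<close>.\<close>

definition sign_point :: "nat \<Rightarrow> nat \<Rightarrow> (nat \<Rightarrow>\<^sub>C real)" where
  "sign_point m i = (THE x. x \<in> linfty (2 ^ m) \<and>
     (\<forall>j<2 ^ m. apply_bcontfun x j = (if i \<in> set_decode j then - 1 else 1)))"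

lemma sign_point_in_linfty: "sign_point m i \<in> linfty (2 ^ m)"
  and apply_sign_point: "j < 2 ^ m \<Longrightarrow>
    apply_bcontfun (sign_point m i) j = (if i \<in> set_decode j then - 1 else 1)"
  using theI'[OF ex1_linfty[of "2 ^ m" "\<lambda>j. if i \<in> set_decode j then - 1 else 1"],
      folded sign_point_def] by simp_all

lemma apply_sign_point_encode:
  assumes "S \<subseteq> {..<m}"
  shows "apply_bcontfun (sign_point m i) (set_encode S) = (if i \<in> S then - 1 else 1)"
  using assms by (simp add: apply_sign_point set_encode_less_power
      finite_subset[OF _ finite_lessThan])

lemma dist_sign_point_le: "dist (sign_point m i) (sign_point m i') \<le> 2"
  unfolding dist_norm
proof (rule norm_bound)
  fix j
  show "norm (apply_bcontfun (sign_point m i - sign_point m i') j) \<le> 2"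
    using sign_point_in_linfty[of m] apply_sign_point[of j m]
    by (cases "j < 2 ^ m") (auto simp: linfty_def)
qed

text \<open>The coordinate of the singleton \<open>{i}\<close> separates the two points.\<close>

lemma sign_point_neq:
  assumes "i < m" "i \<noteq> i'"
  shows "sign_point m i \<noteq> sign_point m i'"
  using apply_sign_point_encode[of "{i}" m i] apply_sign_point_encode[of "{i}" m i'] assms by auto

lemma dist_barycentre_conv_upto:
  assumes m: "m > 0" and y: "y \<in> conv_upto k (sign_point m ` {..<m})"
  shows "2 * (1 - real k / real m) \<le> dist (\<Sum>i<m. (1 / real m) *\<^sub>R sign_point m i) y"
    (is "_ \<le> dist ?a y")
proof -
  obtain s c x where y_eq: "y = (\<Sum>i<s. c i *\<^sub>R x i)" and s: "s \<le> k"
    and x: "\<forall>i<s. x i \<in> sign_point m ` {..<m}" and c: "(\<Sum>i<s. c i) = (1::real)"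
    using y unfolding conv_upto_def by auto
  \<comment> \<open>The points \<open>x i\<close> may repeat, so \<open>S\<close> collects their
    indices as an image of \<open>{..<s}\<close>, which has at most \<open>s \<le> k\<close>
    elements.\<close>
  define t where "t i = inv_into {..<m} (sign_point m) (x i)" for i
  have t: "t i < m \<and> x i = sign_point m (t i)" if "i < s" for i
    using x that inv_into_into[of "x i" "sign_point m" "{..<m}"]
    by (simp add: t_def f_inv_into_f)
  define S where "S = t ` {..<s}"
  have S: "S \<subseteq> {..<m}"
    using t by (auto simp: S_def)
  have "card S \<le> k"
    using card_image_le[of "{..<s}" t] s by (simp add: S_def)
  have coord_y: "apply_bcontfun y (set_encode S) = - 1"
  proof -
    \<comment> \<open>Every point used has its index in \<open>S\<close>, hence the same coordinate
      there, whatever the weights.\<close>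
    have "apply_bcontfun (x i) (set_encode S) = - 1" if "i < s" for i
    proof -
      have "t i \<in> S"
        using that by (simp add: S_def)
      then show ?thesis
        using t[OF that] by (simp add: apply_sign_point_encode[OF S])
    qed
    then have "apply_bcontfun y (set_encode S) = (\<Sum>i<s. c i * - 1)"
      unfolding y_eq apply_bcontfun_sum by (intro sum.cong) auto
    then show ?thesis
      using c by (simp add: sum_negf)
  qed
  have coord_a: "apply_bcontfun ?a (set_encode S) = 1 - 2 * real (card S) / real m"
  proof -
    \<comment> \<open>Writing the sign as \<open>1 - 2 * indicator S i\<close> turns the average
      into a count of \<open>S\<close>.\<close>
    have "apply_bcontfun ?a (set_encode S) = (\<Sum>i<m. (1 / real m) * (1 - 2 * indicator S i))"
      unfolding apply_bcontfun_sum
      by (intro sum.cong) (auto simp: apply_sign_point_encode[OF S])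
    also have "\<dots> = (1 / real m) * (real m - 2 * (\<Sum>i<m. indicator S i))"
      by (simp only: sum_distrib_left[symmetric] sum_subtractf) simp
    also have "(\<Sum>i<m. indicator S i) = real (card S)"
      using S by (simp add: indicator_def Int_absorb1)
    finally show ?thesis
      using m by (simp add: field_simps)
  qed
  have "2 * (1 - real k / real m) \<le> 2 * (1 - real (card S) / real m)"
    using \<open>card S \<le> k\<close> m by (simp add: divide_right_mono)
  also have "\<dots> \<le> dist (apply_bcontfun ?a (set_encode S)) (apply_bcontfun y (set_encode S))"
    unfolding coord_y coord_a by (simp add: dist_real_def)
  also have "\<dots> \<le> dist ?a y"
    by (rule dist_bounded)
  finally show ?thesis .
qed

lemma Car_linfty_ge:
  assumes k: "1 \<le> k" "k < m"
  shows "1 - real k / real m \<le> Car (linfty (2 ^ m)) k"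
proof -
  let ?P = "sign_point m ` {..<m}" and ?a = "\<Sum>i<m. (1 / real m) *\<^sub>R sign_point m i"
  have bdd: "bounded ?P"
    by (intro finite_imp_bounded) simp
  have diam_le: "diameter ?P \<le> 2"
    by (rule diameter_le) (use k in \<open>auto simp flip: dist_norm intro: dist_sign_point_le\<close>)
  \<comment> \<open>From \<open>1 \<le> k < m\<close> it follows that \<open>m \<ge> 2\<close>, so
    the indices 0 and 1 both occur.\<close>
  have "dist (sign_point m 0) (sign_point m 1) \<le> diameter ?P"
    using k by (intro diameter_bounded_bound[OF bdd]) auto
  moreover have "sign_point m 0 \<noteq> sign_point m 1"
    using k by (intro sign_point_neq) auto
  ultimately have diam_pos: "diameter ?P > 0"
    by (metis order_less_le_trans zero_less_dist_iff)
  have "?a \<in> convex hull ?P"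
    using k by (intro convex_sum) (auto intro: hull_inc)
  then have Car: "infdist ?a (conv_upto k ?P) / diameter ?P \<le> Car (linfty (2 ^ m)) k"
    using bdd diam_pos sign_point_in_linfty by (intro Car_lower_bound[OF k(1)]) auto
  \<comment> \<open>\<open>infdist\<close> to the empty set is 0 by convention; nonemptiness makes
    it a true infimum.\<close>
  have ne: "conv_upto k ?P \<noteq> {}"
    using k by (intro conv_upto_nonempty[of k "sign_point m 0"]) auto
  have "2 * (1 - real k / real m) \<le> infdist ?a (conv_upto k ?P)"
    unfolding infdist_notempty[OF ne]
    using k by (intro cINF_greatest[OF ne] dist_barycentre_conv_upto) auto
  \<comment> \<open>The factor is nonnegative because \<open>k < m\<close>, so an upper bound on the
    diameter suffices.\<close>
  moreover have "(1 - real k / real m) * diameter ?P \<le> (1 - real k / real m) * 2"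
    using diam_le k by (intro mult_left_mono) auto
  ultimately have "(1 - real k / real m) * diameter ?P \<le> infdist ?a (conv_upto k ?P)"
    by (simp only: mult.commute[of _ 2] order_trans)
  then have "1 - real k / real m \<le> infdist ?a (conv_upto k ?P) / diameter ?P"
    by (simp only: pos_le_divide_eq[OF diam_pos])
  then show ?thesis
    using Car by linarith
qed

theorem lemma10p2:
  shows "(\<forall>m k :: nat. 1 \<le> k \<and> k < m \<longrightarrow>
            Car (linfty (2 ^ m)) k \<ge> 1 - real k / real m) \<and>
         (\<forall>k :: nat. 1 \<le> k \<longrightarrow> Car (linfty (2 ^ (2 * k))) k \<ge> 1 / 2)"
proof (intro conjI allI impI)
  fix m k :: nat
  assume "1 \<le> k \<and> k < m"
  then show "Car (linfty (2 ^ m)) k \<ge> 1 - real k / real m"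
    by (simp add: Car_linfty_ge)
next
  fix k :: nat
  assume "1 \<le> k"
  then show "Car (linfty (2 ^ (2 * k))) k \<ge> 1 / 2"
    \<comment> \<open>For \<open>m = 2 * k\<close> the bound is exactly 1/2, and
      \<open>k \<ge> 1\<close> gives \<open>k < m\<close>.\<close>
    using Car_linfty_ge[of k "2 * k"] by simp
qed

end
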